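(* Let $X\subset\mathbb{R}$ be an interval and $(X,T,\mu)$ a probability preserving dynamical system which is exponentially 4-mixing for $BV$ against $L^\infty$, with the constant $C'$ uniformly bounded when $\psi_1,\psi_2,\varphi_1,\varphi_2$ are indicator functions of intervals. Let $(r_n)_n$ be a sequence of positive numbers with $r_n\ge n^{-\beta}$ for some $\beta>0$, and suppose that for some function $h(n)\to\infty$, \[ \int\mu(B(y,r_n))\,d\mu(y)\ge\frac{(\log n)^2h(n)}{n^2} \] for all large $n$. Then $\mu(\limsup_n F_{n,4r_n}^T)=1$.
   Context: $(X,T,\mu)$ is exponentially 4-mixing for $BV$ against $L^\infty$ if there is $\theta'>0$ such that for all $\psi_1,\psi_2$ of bounded variation, all $\varphi_1,\varphi_2\in L^\infty(\mu)$, and all integers $0\le a<b\le c$, $\bigl|\int\psi_1\cdot\psi_2\circ T^a\cdot\varphi_1\circ T^b\cdot\varphi_2\circ T^c\,d\mu-\int\psi_1\cdot\psi_2\circ T^a\,d\mu\int\varphi_1\cdot\varphi_2\circ T^{c-b}\,d\mu\bigr|\le C'(\psi_1,\psi_2,\varphi_1,\varphi_2)e^{-\theta'(b-a)}$ for some constant $C'(\psi_1,\psi_2,\varphi_1,\varphi_2)<\infty$. For $n\in\mathbb{N}$, $r>0$: $F_{n,r}^T:=\{x\in X: |T^ix-T^jx|<r \text{ for some } 0\le i<j<n\}$; $F_{n,4r_n}^T$ is this set with $r=4r_n$. $B(y,r)$ is the open ball of radius $r$ about $y$. *)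

theory Defs
  imports "HOL-Probability.Probability"
begin

definition bv_on :: "real set \<Rightarrow> (real \<Rightarrow> real) \<Rightarrow> bool" where
  "bv_on X f \<longleftrightarrow> (\<exists>B. \<forall>xs. sorted_wrt (<) xs \<and> set xs \<subseteq> X \<longrightarrow>
      (\<Sum>i<length xs - 1. \<bar>f (xs ! Suc i) - f (xs ! i)\<bar>) \<le> B)"

definition Linfty :: "'a measure \<Rightarrow> ('a \<Rightarrow> real) \<Rightarrow> bool" where
  "Linfty M f \<longleftrightarrow> f \<in> borel_measurable M \<and> (\<exists>B. AE x in M. \<bar>f x\<bar> \<le> B)"

definition corr4 :: "real measure \<Rightarrow> (real \<Rightarrow> real) \<Rightarrow> (real \<Rightarrow> real) \<Rightarrow> (real \<Rightarrow> real)
    \<Rightarrow> (real \<Rightarrow> real) \<Rightarrow> (real \<Rightarrow> real) \<Rightarrow> nat \<Rightarrow> nat \<Rightarrow> nat \<Rightarrow> real" where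
  "corr4 M T \<psi>1 \<psi>2 \<phi>1 \<phi>2 a b c =
     \<bar>(\<integral>x. \<psi>1 x * \<psi>2 ((T ^^ a) x) * \<phi>1 ((T ^^ b) x) * \<phi>2 ((T ^^ c) x) \<partial>M)
       - (\<integral>x. \<psi>1 x * \<psi>2 ((T ^^ a) x) \<partial>M) * (\<integral>x. \<phi>1 x * \<phi>2 ((T ^^ (c - b)) x) \<partial>M)\<bar>"

definition exp_4mixing_BV_Linfty_unif :: "real measure \<Rightarrow> (real \<Rightarrow> real) \<Rightarrow> bool" where
  "exp_4mixing_BV_Linfty_unif M T \<longleftrightarrow>
    (\<exists>\<theta>>0.
      (\<forall>\<psi>1 \<psi>2 \<phi>1 \<phi>2. bv_on (space M) \<psi>1 \<longrightarrow> bv_on (space M) \<psi>2 \<longrightarrow>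
          Linfty M \<phi>1 \<longrightarrow> Linfty M \<phi>2 \<longrightarrow>
          (\<exists>C. \<forall>a b c. a < b \<and> b \<le> c \<longrightarrow>
              corr4 M T \<psi>1 \<psi>2 \<phi>1 \<phi>2 a b c \<le> C * exp (- \<theta> * real (b - a)))) \<and>
      (\<exists>C. \<forall>I1 I2 I3 I4. is_interval I1 \<and> is_interval I2 \<and> is_interval I3 \<and> is_interval I4 \<longrightarrow>
          (\<forall>a b c. a < b \<and> b \<le> c \<longrightarrow>
              corr4 M T (indicator I1) (indicator I2) (indicator I3) (indicator I4) a b c
                \<le> C * exp (- \<theta> * real (b - a)))))"

definition Fset :: "real measure \<Rightarrow> (real \<Rightarrow> real) \<Rightarrow> nat \<Rightarrow> real \<Rightarrow> real set" where
  "Fset M T n r = {x \<in> space M. \<exists>i j. i < j \<and> j < n \<and> \<bar>(T ^^ i) x - (T ^^ j) x\<bar> < r}"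

end

theory Submission
  imports Defs "HOL-Real_Asymp.Real_Asymp"
begin

text \<open>It suffices that the probability of \<open>F\<^sub>n\<close> tends to \<open>1\<close>, which follows from a second moment
  estimate. Cut the line into cells \<open>J\<^sub>k\<close> of length \<open>4r\<close>, so that two points of one cell are closer
  than \<open>4r\<close>, and let \<open>S\<close> count the triples \<open>(i, j, k)\<close> with \<open>T\<^sup>i x, T\<^sup>j x \<in> J\<^sub>k\<close>, where \<open>i\<close> runs through
  the first and \<open>j\<close> through the last third of \<open>{0..<n}\<close>. With \<open>q = \<Sum>\<^sub>k \<mu>(J\<^sub>k)\<^sup>2\<close>, which is comparable to
  the correlation integral, the mean of \<open>S\<close> is about \<open>(n/3)\<^sup>2 q\<close>. Since the two blocks of times
  are far apart, 4-mixing reduces the second moment to the squares of the pair correlations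
  \<open>\<Sum>\<^sub>i\<^sub>,\<^sub>i\<^sub>' \<mu>(T\<^sup>i x \<in> J\<^sub>k, T\<^sup>i\<^sup>' x \<in> J\<^sub>l)\<close>. Pairs with \<open>\<bar>i - i'\<bar> \<ge> g\<close>, where \<open>g\<close> is a large multiple of
  \<open>log n\<close>, decorrelate; the remaining ones contribute a relative error of order \<open>g / (n \<surd>q)\<close>, which
  tends to \<open>0\<close> because \<open>n\<^sup>2 q\<close> dominates \<open>(log n)\<^sup>2 h(n)\<close>.\<close>

section \<open>An inequality for perturbed sums of squares\<close>

text \<open>This is the shape in which pair correlations enter the second moment:
  \<open>a * (\<mu> k * \<mu> l)\<close> is the decorrelated part, \<open>e\<close> the mixing
  error, \<open>B\<close> the share of close times. Since the rows and columns of \<open>B\<close>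
  sum to at most \<open>G * \<mu>\<close> and the cubes of \<open>\<mu>\<close> to at most
  \<open>q * sqrt q\<close>, the cross term with \<open>B\<close> is smaller than the leading
  \<open>a\<^sup>2 * q\<^sup>2\<close> by a factor of order \<open>G / (a * sqrt q)\<close>.\<close>

lemma sum_squares_perturbed_le:
  fixes \<mu> :: "'k \<Rightarrow> real" and B :: "'k \<Rightarrow> 'k \<Rightarrow> real" and a e G :: real
  assumes K: "finite K" and \<mu>: "\<And>k. k \<in> K \<Longrightarrow> 0 \<le> \<mu> k" "(\<Sum>k\<in>K. \<mu> k) \<le> 1"
    and nonneg: "0 \<le> a" "0 \<le> e" "0 \<le> G"
    and B: "\<And>k l. k \<in> K \<Longrightarrow> l \<in> K \<Longrightarrow> 0 \<le> B k l"
      "\<And>k l. k \<in> K \<Longrightarrow> l \<in> K \<Longrightarrow> B k l \<le> G * \<mu> k"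
    and row: "\<And>k. k \<in> K \<Longrightarrow> (\<Sum>l\<in>K. B k l) \<le> G * \<mu> k"
    and col: "\<And>l. l \<in> K \<Longrightarrow> (\<Sum>k\<in>K. B k l) \<le> G * \<mu> l"
  defines "q \<equiv> \<Sum>k\<in>K. (\<mu> k)\<^sup>2"
  shows "(\<Sum>k\<in>K. \<Sum>l\<in>K. (a * (\<mu> k * \<mu> l) + e + B k l)\<^sup>2)
    \<le> a\<^sup>2 * q\<^sup>2 + 2 * a * (e + G * (q * sqrt q)) + 2 * ((real (card K))\<^sup>2 * e\<^sup>2 + G\<^sup>2 * q)"
proof -
  have q0: "0 \<le> q" unfolding q_def by (simp add: sum_nonneg)
  have \<mu>_le: "\<mu> k \<le> sqrt q" if "k \<in> K" for k
    unfolding q_def using that K by (intro real_le_rsqrt member_le_sum) auto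
  have cube: "(\<Sum>k\<in>K. \<mu> k * (\<mu> k)\<^sup>2) \<le> q * sqrt q"
  proof -
    have "(\<Sum>k\<in>K. \<mu> k * (\<mu> k)\<^sup>2) \<le> (\<Sum>k\<in>K. sqrt q * (\<mu> k)\<^sup>2)"
      using \<mu>_le by (intro sum_mono mult_right_mono) auto
    also have "\<dots> = q * sqrt q" by (simp add: q_def sum_distrib_left[symmetric])
    finally show ?thesis .
  qed
  have qq: "(\<Sum>k\<in>K. \<Sum>l\<in>K. (\<mu> k * \<mu> l)\<^sup>2) = q\<^sup>2"
    unfolding q_def by (simp add: power2_eq_square[of "sum _ _"] sum_product power_mult_distrib)
  have one: "(\<Sum>k\<in>K. \<Sum>l\<in>K. \<mu> k * \<mu> l) \<le> 1"
  proof -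
    have "(\<Sum>k\<in>K. \<Sum>l\<in>K. \<mu> k * \<mu> l) = (\<Sum>k\<in>K. \<mu> k) * (\<Sum>k\<in>K. \<mu> k)"
      by (simp add: sum_product)
    also have "\<dots> \<le> 1" using \<mu> by (intro mult_le_one sum_nonneg) auto
    finally show ?thesis .
  qed
  have sqB1: "(\<Sum>k\<in>K. \<Sum>l\<in>K. (\<mu> k)\<^sup>2 * B k l) \<le> G * (q * sqrt q)"
  proof -
    have "(\<Sum>k\<in>K. \<Sum>l\<in>K. (\<mu> k)\<^sup>2 * B k l) \<le> (\<Sum>k\<in>K. (\<mu> k)\<^sup>2 * (G * \<mu> k))"
      unfolding sum_distrib_left[symmetric] using row by (intro sum_mono mult_left_mono) auto
    also have "\<dots> = G * (\<Sum>k\<in>K. \<mu> k * (\<mu> k)\<^sup>2)"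
      by (simp add: sum_distrib_left mult_ac)
    also have "\<dots> \<le> G * (q * sqrt q)" using cube nonneg by (intro mult_left_mono) auto
    finally show ?thesis .
  qed
  have sqB2: "(\<Sum>k\<in>K. \<Sum>l\<in>K. (\<mu> l)\<^sup>2 * B k l) \<le> G * (q * sqrt q)"
  proof -
    have "(\<Sum>k\<in>K. \<Sum>l\<in>K. (\<mu> l)\<^sup>2 * B k l) = (\<Sum>l\<in>K. (\<mu> l)\<^sup>2 * (\<Sum>k\<in>K. B k l))"
      by (subst sum.swap) (simp add: sum_distrib_left)
    also have "\<dots> \<le> (\<Sum>k\<in>K. (\<mu> k)\<^sup>2 * (G * \<mu> k))"
      using col by (intro sum_mono mult_left_mono) auto
    also have "\<dots> = G * (\<Sum>k\<in>K. \<mu> k * (\<mu> k)\<^sup>2)"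
      by (simp add: sum_distrib_left mult_ac)
    also have "\<dots> \<le> G * (q * sqrt q)" using cube nonneg by (intro mult_left_mono) auto
    finally show ?thesis .
  qed
  have mB: "(\<Sum>k\<in>K. \<Sum>l\<in>K. \<mu> k * \<mu> l * B k l) \<le> G * (q * sqrt q)"
  proof -
    \<comment> \<open>The inequality of arithmetic and geometric means separates the weights: the
      square of \<open>\<mu> k\<close> meets a row sum of \<open>B\<close>, that of
      \<open>\<mu> l\<close> a column sum.\<close>
    have "(\<Sum>k\<in>K. \<Sum>l\<in>K. \<mu> k * \<mu> l * B k l)
        \<le> (\<Sum>k\<in>K. \<Sum>l\<in>K. ((\<mu> k)\<^sup>2 / 2 + (\<mu> l)\<^sup>2 / 2) * B k l)"
    proof (intro sum_mono mult_right_mono B)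
      fix k l
      have "0 \<le> (\<mu> k - \<mu> l)\<^sup>2" by simp
      then show "\<mu> k * \<mu> l \<le> (\<mu> k)\<^sup>2 / 2 + (\<mu> l)\<^sup>2 / 2"
        unfolding power2_diff by simp
    qed
    also have "\<dots> = (\<Sum>k\<in>K. \<Sum>l\<in>K. (\<mu> k)\<^sup>2 * B k l) / 2 + (\<Sum>k\<in>K. \<Sum>l\<in>K. (\<mu> l)\<^sup>2 * B k l) / 2"
      by (simp add: distrib_right sum.distrib sum_divide_distrib)
    finally show ?thesis using sqB1 sqB2 by simp
  qed
  have BB: "(\<Sum>k\<in>K. \<Sum>l\<in>K. (B k l)\<^sup>2) \<le> G\<^sup>2 * q"
  proof -
    have "(\<Sum>k\<in>K. \<Sum>l\<in>K. (B k l)\<^sup>2) \<le> (\<Sum>k\<in>K. G * \<mu> k * (\<Sum>l\<in>K. B k l))"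
      unfolding sum_distrib_left power2_eq_square using B
      by (intro sum_mono mult_right_mono) auto
    also have "\<dots> \<le> (\<Sum>k\<in>K. G * \<mu> k * (G * \<mu> k))"
      using row nonneg \<mu> by (intro sum_mono mult_left_mono) auto
    also have "\<dots> = G\<^sup>2 * q"
      by (simp add: q_def sum_distrib_left power2_eq_square mult_ac)
    finally show ?thesis .
  qed
  \<comment> \<open>The mixed term of \<open>e\<close> and \<open>B\<close> is absorbed by their
    squares, whence the factor 2 in the last summand.\<close>
  have "(a * (\<mu> k * \<mu> l) + e + B k l)\<^sup>2
      \<le> a\<^sup>2 * (\<mu> k * \<mu> l)\<^sup>2 + 2 * a * (e * (\<mu> k * \<mu> l) + \<mu> k * \<mu> l * B k l) + 2 * (e\<^sup>2 + (B k l)\<^sup>2)"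
    for k l
  proof -
    have "0 \<le> (e - B k l)\<^sup>2" by simp
    then show ?thesis by (simp add: power2_eq_square algebra_simps)
  qed
  then have "(\<Sum>k\<in>K. \<Sum>l\<in>K. (a * (\<mu> k * \<mu> l) + e + B k l)\<^sup>2)
      \<le> (\<Sum>k\<in>K. \<Sum>l\<in>K. a\<^sup>2 * (\<mu> k * \<mu> l)\<^sup>2
          + 2 * a * (e * (\<mu> k * \<mu> l) + \<mu> k * \<mu> l * B k l) + 2 * (e\<^sup>2 + (B k l)\<^sup>2))"
    by (intro sum_mono)
  also have "\<dots> = a\<^sup>2 * (\<Sum>k\<in>K. \<Sum>l\<in>K. (\<mu> k * \<mu> l)\<^sup>2)
      + 2 * a * (e * (\<Sum>k\<in>K. \<Sum>l\<in>K. \<mu> k * \<mu> l) + (\<Sum>k\<in>K. \<Sum>l\<in>K. \<mu> k * \<mu> l * B k l))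
      + 2 * ((real (card K))\<^sup>2 * e\<^sup>2 + (\<Sum>k\<in>K. \<Sum>l\<in>K. (B k l)\<^sup>2))"
    by (simp add: sum.distrib sum_distrib_left[symmetric] power2_eq_square[of "real (card K)"])
  also have "\<dots> \<le> a\<^sup>2 * q\<^sup>2 + 2 * a * (e * 1 + G * (q * sqrt q))
      + 2 * ((real (card K))\<^sup>2 * e\<^sup>2 + G\<^sup>2 * q)"
    unfolding qq using mB BB one nonneg by (intro add_mono mult_left_mono order_refl) auto
  finally show ?thesis by simp
qed

section \<open>Grids of cells on the line\<close>

lemma interval_borel:
  fixes J :: "real set"
  shows "is_interval J \<Longrightarrow> J \<in> sets borel"
  by (simp add: is_interval_convex_1 real_interval_borel_measurable)

text \<open>The half-open interval from \<open>s + 4 * r * k\<close> to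
  \<open>s + 4 * r * (k + 1)\<close>. Through the floor, disjointness and covering of the line are
  immediate.\<close>

definition cell :: "real \<Rightarrow> real \<Rightarrow> int \<Rightarrow> real set" where
  "cell r s k = {x. \<lfloor>(x - s) / (4 * r)\<rfloor> = k}"

lemma disjoint_cells: "disjoint_family_on (cell r s) K"
  by (auto simp: disjoint_family_on_def cell_def)

lemma is_interval_cell: "0 < r \<Longrightarrow> is_interval (cell r s k)"
proof -
  assume r: "0 < r"
  have "\<lfloor>(y - s) / (4 * r)\<rfloor> = k"
    if "\<lfloor>(x - s) / (4 * r)\<rfloor> = k" "\<lfloor>(z - s) / (4 * r)\<rfloor> = k" "x \<le> y" "y \<le> z" for x y z
  proof -
    have "\<lfloor>(x - s) / (4 * r)\<rfloor> \<le> \<lfloor>(y - s) / (4 * r)\<rfloor>" "\<lfloor>(y - s) / (4 * r)\<rfloor> \<le> \<lfloor>(z - s) / (4 * r)\<rfloor>"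
      using that r by (intro floor_mono divide_right_mono; simp)+
    then show ?thesis using that by simp
  qed
  then show ?thesis unfolding is_interval_1 cell_def by blast
qed

text \<open>Numbers with the same floor differ by less than 1. The inequality is strict, as in
  \<open>Fset\<close>.\<close>

lemma cell_diameter:
  assumes "0 < r" "x \<in> cell r s k" "y \<in> cell r s k"
  shows "\<bar>x - y\<bar> < 4 * r"
proof -
  have "\<bar>(x - s) / (4 * r) - (y - s) / (4 * r)\<bar> < 1"
    using assms(2,3) unfolding cell_def by simp linarith
  then show ?thesis
    using \<open>0 < r\<close> by (simp add: diff_divide_distrib[symmetric] abs_divide divide_less_eq)
qed

text \<open>In units of the mesh, the ball is an interval of radius 1/4 about \<open>z\<close>. If
  the fractional part of \<open>z\<close> lies between 1/4 and 3/4, no integer falls inside it.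
  Otherwise \<open>z\<close> is within 1/4 of an integer, hence at least 1/4 away from the
  half-integers, which bound the cells of the shifted grid.\<close>

lemma ball_subset_cell:
  assumes "0 < r"
  shows "ball y r \<subseteq> cell r 0 \<lfloor>y / (4 * r)\<rfloor> \<or> ball y r \<subseteq> cell r (2 * r) \<lfloor>(y - 2 * r) / (4 * r)\<rfloor>"
proof -
  define z where "z = y / (4 * r)"
  have shift: "(x - 2 * r) / (4 * r) = x / (4 * r) - 1 / 2" for x
    using assms by (simp add: field_simps)
  have near: "\<bar>x / (4 * r) - z\<bar> < 1 / 4" if "x \<in> ball y r" for x
    using that assms unfolding z_def
    by (simp add: diff_divide_distrib[symmetric] abs_divide divide_less_eq dist_real_def)
  show ?thesis
  proof (cases "of_int \<lfloor>z\<rfloor> + 1 / 4 \<le> z \<and> z \<le> of_int \<lfloor>z\<rfloor> + 3 / 4")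
    case True
    have "\<lfloor>x / (4 * r)\<rfloor> = \<lfloor>z\<rfloor>" if "x \<in> ball y r" for x
      using near[OF that] True by linarith
    then show ?thesis by (auto simp: cell_def z_def)
  next
    case False
    have "\<lfloor>x / (4 * r) - 1 / 2\<rfloor> = \<lfloor>z - 1 / 2\<rfloor>" if "x \<in> ball y r" for x
    proof (cases "z < of_int \<lfloor>z\<rfloor> + 1 / 4")
      case True
      then have "\<lfloor>z - 1 / 2\<rfloor> = \<lfloor>z\<rfloor> - 1" "\<lfloor>x / (4 * r) - 1 / 2\<rfloor> = \<lfloor>z\<rfloor> - 1"
        using near[OF that] unfolding floor_eq_iff by (auto; linarith)+
      then show ?thesis by simp
    next
      case z: False
      then have "\<lfloor>z - 1 / 2\<rfloor> = \<lfloor>z\<rfloor>" "\<lfloor>x / (4 * r) - 1 / 2\<rfloor> = \<lfloor>z\<rfloor>"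
        using near[OF that] False unfolding floor_eq_iff by (auto; linarith)+
      then show ?thesis by simp
    qed
    then show ?thesis by (auto simp: cell_def shift z_def)
  qed
qed

lemma cell_borel [measurable]: "0 < r \<Longrightarrow> cell r s k \<in> sets borel"
  by (intro interval_borel is_interval_cell)

section \<open>Upper limits of events whose probability tends to 1\<close>

text \<open>Each tail union contains all later events and so has probability 1, and the upper limit
  is the countable intersection of the tail unions.\<close>

lemma (in prob_space) prob_limsup_eq_1:
  assumes [measurable]: "\<And>n. A n \<in> sets M" and lim: "(\<lambda>n. measure M (A n)) \<longlonglongrightarrow> 1"
  shows "measure M (limsup A) = 1"
proof -
  have "measure M (\<Union>k\<in>{n..}. A k) = 1" for n
  proof (rule antisym)
    have "eventually (\<lambda>k. measure M (A k) \<le> measure M (\<Union>k\<in>{n..}. A k)) sequentially"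
      using eventually_ge_at_top[of n] by eventually_elim (auto intro!: finite_measure_mono)
    then show "1 \<le> measure M (\<Union>k\<in>{n..}. A k)"
      using lim by (intro tendsto_upperbound[OF lim]) auto
  qed simp
  then have "AE x in M. x \<in> (\<Union>k\<in>{n..}. A k)" for n
    by (intro AE_prob_1)
  then have "AE x in M. \<forall>n. x \<in> (\<Union>k\<in>{n..}. A k)" by (simp add: AE_all_countable)
  then have "AE x in M. x \<in> limsup A" by (simp add: limsup_INF_SUP)
  then show ?thesis by (subst prob_eq_1) auto
qed

section \<open>Stationarity of the visits to intervals\<close>

text \<open>A single constant \<open>C\<close> serves all intervals, so that mixing can be applied
  to all cells of a grid that varies with \<open>n\<close>.\<close>

locale interval_mixing = prob_space M for M :: "real measure" +
  fixes T :: "real \<Rightarrow> real" and C \<theta> :: real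
  assumes sets_M: "sets M = sets (restrict_space borel (space M))"
    and T_measurable [measurable]: "T \<in> M \<rightarrow>\<^sub>M M"
    and T_preserving: "distr M M T = M"
    and C_nonneg: "0 \<le> C" and \<theta>_pos: "0 < \<theta>"
    and mixing: "\<And>I1 I2 I3 I4 a b c. is_interval I1 \<Longrightarrow> is_interval I2 \<Longrightarrow> is_interval I3 \<Longrightarrow>
      is_interval I4 \<Longrightarrow> a < b \<Longrightarrow> b \<le> c \<Longrightarrow>
      corr4 M T (indicator I1) (indicator I2) (indicator I3) (indicator I4) a b c
        \<le> C * exp (- \<theta> * real (b - a))"
begin

definition hit :: "nat \<Rightarrow> real set \<Rightarrow> real \<Rightarrow> real" where
  "hit i J x = indicator J ((T ^^ i) x)"

lemma measurable_M_borel [measurable]: "(\<lambda>x. x) \<in> M \<rightarrow>\<^sub>M borel"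
proof -
  have "(\<lambda>x. x) \<in> restrict_space borel (space M) \<rightarrow>\<^sub>M borel"
    by (intro measurable_restrict_space1) simp
  then show ?thesis
    by (subst measurable_cong_sets[OF sets_M refl])
qed

lemma iterate_measurable [measurable]: "T ^^ i \<in> M \<rightarrow>\<^sub>M M"
  by (induction i) (auto simp: id_def intro: measurable_comp[OF _ T_measurable])

lemma iterate_measurable_borel [measurable]: "T ^^ i \<in> M \<rightarrow>\<^sub>M borel"
  using measurable_comp[OF iterate_measurable measurable_M_borel, of i] by (simp add: comp_def)

lemma borel_Int_space [measurable]: "J \<in> sets borel \<Longrightarrow> J \<inter> space M \<in> sets M"
  using measurable_sets[OF measurable_M_borel, of J] by simp

lemma distr_iterate: "distr M M (T ^^ i) = M"
proof (induction i)
  case 0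
  show ?case by (simp add: id_def distr_id)
next
  case (Suc i)
  have "distr M M (T ^^ Suc i) = distr (distr M M (T ^^ i)) M T"
    by (subst distr_distr) auto
  then show ?case unfolding Suc T_preserving .
qed

lemma integral_iterate:
  fixes f :: "real \<Rightarrow> real"
  assumes [measurable]: "f \<in> borel_measurable M"
  shows "(\<integral>x. f ((T ^^ i) x) \<partial>M) = (\<integral>x. f x \<partial>M)"
  using integral_distr[OF iterate_measurable assms, of i] by (simp add: distr_iterate)

lemma hit_measurable [measurable]:
  assumes [measurable]: "J \<in> sets borel"
  shows "hit i J \<in> borel_measurable M"
proof -
  have "(\<lambda>x. indicator J ((T ^^ i) x) :: real) \<in> borel_measurable M" by measurable
  then show ?thesis unfolding hit_def[abs_def] .
qed

lemma hit_nonneg [simp]: "0 \<le> hit i J x"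
  and hit_le_1 [simp]: "hit i J x \<le> 1"
  by (auto simp: hit_def indicator_def)

lemma integrable_hit2 [simp]:
  assumes [measurable]: "J \<in> sets borel" "L \<in> sets borel"
  shows "integrable M (\<lambda>x. hit i J x * hit j L x)"
  by (rule integrable_const_bound[where B = 1]) (auto simp: hit_def indicator_def)

lemma integrable_hit [simp]: "J \<in> sets borel \<Longrightarrow> integrable M (hit i J)"
  by (rule integrable_const_bound[where B = 1]) auto

lemma integrable_hit4 [simp]:
  assumes [measurable]: "J1 \<in> sets borel" "J2 \<in> sets borel" "J3 \<in> sets borel" "J4 \<in> sets borel"
  shows "integrable M (\<lambda>x. hit i J1 x * hit i' J2 x * (hit j J3 x * hit j' J4 x))"
  by (rule integrable_const_bound[where B = 1]) (auto simp: hit_def indicator_def)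

lemma integral_hit:
  assumes [measurable]: "J \<in> sets borel"
  shows "(\<integral>x. hit i J x \<partial>M) = measure M (J \<inter> space M)"
proof -
  have "(\<integral>x. hit i J x \<partial>M) = (\<integral>x. indicator J x \<partial>M)"
    unfolding hit_def by (rule integral_iterate) simp
  then show ?thesis by simp
qed

lemma hit_iterate: "hit i J ((T ^^ j) x) = hit (i + j) J x"
  by (simp add: hit_def funpow_add)

lemma integral_hit2_shift:
  assumes [measurable]: "J \<in> sets borel" "L \<in> sets borel"
  shows "(\<integral>x. hit (i + s) J x * hit (j + s) L x \<partial>M) = (\<integral>x. hit i J x * hit j L x \<partial>M)"
  using integral_iterate[of "\<lambda>x. hit i J x * hit j L x" s] by (simp add: hit_iterate)

section \<open>Correlations at two and at four times\<close>

text \<open>The case of 4-mixing in which the second and fourth functions are the constant 1, with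
  first time gap 0; invariance then shifts the times \<open>0\<close> and \<open>j - i\<close> to
  \<open>i\<close> and \<open>j\<close>.\<close>

lemma two_point:
  assumes J: "is_interval J" "is_interval L" and "i < j"
  shows "\<bar>(\<integral>x. hit i J x * hit j L x \<partial>M) - measure M (J \<inter> space M) * measure M (L \<inter> space M)\<bar>
    \<le> C * exp (- \<theta> * real (j - i))"
proof -
  have [measurable]: "J \<in> sets borel" "L \<in> sets borel"
    using J by (auto intro: interval_borel)
  have "corr4 M T (indicator J) (indicator UNIV) (indicator L) (indicator UNIV) 0 (j - i) (j - i)
      \<le> C * exp (- \<theta> * real (j - i - 0))"
    using assms by (intro mixing) auto
  moreover have "(\<integral>x. indicator J x * indicator L ((T ^^ (j - i)) x) \<partial>M)
      = (\<integral>x. hit i J x * hit j L x \<partial>M)"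
    using integral_hit2_shift[of J L 0 i "j - i"] \<open>i < j\<close> by (simp add: hit_def)
  ultimately show ?thesis by (simp add: corr4_def)
qed

text \<open>Invariance moves the earliest time \<open>i\<close> to 0. The gap that governs mixing is
  then \<open>j - i'\<close>, which exceeds \<open>d\<close>.\<close>

lemma four_point_ordered:
  assumes J: "is_interval J1" "is_interval J2" "is_interval J3" "is_interval J4"
    and ord: "i \<le> i'" "i' + d < j" "j \<le> j'"
  shows "(\<integral>x. hit i J1 x * hit i' J2 x * (hit j J3 x * hit j' J4 x) \<partial>M)
    \<le> (\<integral>x. hit i J1 x * hit i' J2 x \<partial>M) * (\<integral>x. hit j J3 x * hit j' J4 x \<partial>M)
      + C * exp (- \<theta> * real d)"
proof -
  have [measurable]: "J1 \<in> sets borel" "J2 \<in> sets borel" "J3 \<in> sets borel" "J4 \<in> sets borel"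
    using J by (auto intro: interval_borel)
  let ?a = "i' - i" and ?b = "j - i" and ?c = "j' - i"
  have "corr4 M T (indicator J1) (indicator J2) (indicator J3) (indicator J4) ?a ?b ?c
      \<le> C * exp (- \<theta> * real (?b - ?a))"
    using assms by (intro mixing) auto
  also have "\<dots> \<le> C * exp (- \<theta> * real d)"
    using C_nonneg \<theta>_pos ord by (intro mult_left_mono) auto
  finally have *: "corr4 M T (indicator J1) (indicator J2) (indicator J3) (indicator J4) ?a ?b ?c
      \<le> C * exp (- \<theta> * real d)" .
  have 1: "(\<integral>x. hit i J1 x * hit i' J2 x \<partial>M) = (\<integral>x. hit 0 J1 x * hit ?a J2 x \<partial>M)"
    using integral_hit2_shift[of J1 J2 0 i ?a] ord by simp
  have 2: "(\<integral>x. hit j J3 x * hit j' J4 x \<partial>M) = (\<integral>x. hit 0 J3 x * hit (?c - ?b) J4 x \<partial>M)"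
    using integral_hit2_shift[of J3 J4 0 j "?c - ?b"] ord by simp
  have 3: "(\<integral>x. hit i J1 x * hit i' J2 x * (hit j J3 x * hit j' J4 x) \<partial>M)
      = (\<integral>x. hit 0 J1 x * hit ?a J2 x * (hit ?b J3 x * hit ?c J4 x) \<partial>M)"
    using integral_iterate[of "\<lambda>x. hit 0 J1 x * hit ?a J2 x * (hit ?b J3 x * hit ?c J4 x)" i] ord
    by (simp add: hit_iterate)
  show ?thesis using * unfolding 1 2 3 corr4_def abs_le_iff by (simp add: hit_def mult.assoc)
qed

text \<open>The order within the early pair and within the late pair is arbitrary; commuting the
  factors in each pair reduces all cases to the ordered one.\<close>

lemma four_point:
  assumes J: "is_interval J1" "is_interval J2" "is_interval J3" "is_interval J4"
    and ord: "i + d < j" "i' + d < j" "i + d < j'" "i' + d < j'"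
  shows "(\<integral>x. hit i J1 x * hit i' J2 x * (hit j J3 x * hit j' J4 x) \<partial>M)
    \<le> (\<integral>x. hit i J1 x * hit i' J2 x \<partial>M) * (\<integral>x. hit j J3 x * hit j' J4 x \<partial>M)
      + C * exp (- \<theta> * real d)"
proof (cases "i \<le> i'")
  case True
  show ?thesis
  proof (cases "j \<le> j'")
    case True
    then show ?thesis using assms \<open>i \<le> i'\<close> by (intro four_point_ordered)
  next
    case False
    then show ?thesis using four_point_ordered[of J1 J2 J4 J3 i i' d j' j] assms \<open>i \<le> i'\<close>
      by (simp add: mult.commute[of "hit j J3 _"])
  qed
next
  case False
  show ?thesis
  proof (cases "j \<le> j'")
    case True
    then show ?thesis using four_point_ordered[of J2 J1 J3 J4 i' i d j j'] assms \<open>\<not> i \<le> i'\<close>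
      by (simp add: mult.commute[of "hit i J1 _"])
  next
    case False
    then show ?thesis using four_point_ordered[of J2 J1 J4 J3 i' i d j' j] assms \<open>\<not> i \<le> i'\<close>
      by (simp add: mult.commute[of "hit i J1 _"] mult.commute[of "hit j J3 _"])
  qed
qed

section \<open>Counts of visits and their mixed moments\<close>

text \<open>Used with \<open>s = 0\<close> and \<open>s = 2 * m\<close>, the first and the last
  third of the times below \<open>3 * m\<close>.\<close>

definition visits :: "nat \<Rightarrow> nat \<Rightarrow> real set \<Rightarrow> real \<Rightarrow> real" where
  "visits s m J x = (\<Sum>i<m. hit (i + s) J x)"

text \<open>The times at distance less than \<open>g\<close> from \<open>i\<close>, written with
  sums to avoid truncated subtraction.\<close>

definition close_pairs :: "nat \<Rightarrow> nat \<Rightarrow> nat \<Rightarrow> nat set" where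
  "close_pairs m g i = {i'. i' < m \<and> i < i' + g \<and> i' < i + g}"

lemma finite_close_pairs [simp]: "finite (close_pairs m g i)"
  by (rule finite_subset[of _ "{..<m}"]) (auto simp: close_pairs_def)

lemma card_close_pairs: "card (close_pairs m g i) \<le> 2 * g"
proof -
  have "card (close_pairs m g i) \<le> card {Suc i - g..<i + g}"
    by (intro card_mono) (auto simp: close_pairs_def)
  then show ?thesis by simp
qed

definition close_mass :: "nat \<Rightarrow> nat \<Rightarrow> real set \<Rightarrow> real set \<Rightarrow> real" where
  "close_mass m g J L = (\<Sum>i<m. \<Sum>i'\<in>close_pairs m g i. \<integral>x. hit i J x * hit i' L x \<partial>M)"

lemma close_mass_nonneg: "0 \<le> close_mass m g J L"
  unfolding close_mass_def by (intro sum_nonneg integral_nonneg) auto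

text \<open>Closeness of two times is symmetric. This turns the row bound below into the column
  bound.\<close>

lemma close_mass_commute: "close_mass m g J L = close_mass m g L J"
proof -
  have "close_mass m g J L
      = (\<Sum>i<m. \<Sum>i' | i' \<in> {..<m} \<and> i < i' + g \<and> i' < i + g. \<integral>x. hit i J x * hit i' L x \<partial>M)"
    unfolding close_mass_def close_pairs_def by simp
  also have "\<dots> = (\<Sum>i'<m. \<Sum>i | i \<in> {..<m} \<and> i < i' + g \<and> i' < i + g.
      \<integral>x. hit i J x * hit i' L x \<partial>M)"
    by (rule sum.swap_restrict) auto
  also have "\<dots> = close_mass m g L J"
    unfolding close_mass_def close_pairs_def
    by (intro sum.cong) (auto simp: mult.commute conj_commute)
  finally show ?thesis .
qed

text \<open>At a given time the orbit lies in at most one of the disjoint sets \<open>L k\<close>,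
  so for fixed times the sum over \<open>k\<close> is at most the measure of \<open>J\<close>. There
  are at most \<open>2 * g * m\<close> close pairs of times.\<close>

lemma close_mass_row:
  assumes "finite K" and J [measurable]: "J \<in> sets borel"
    and L: "\<And>k. k \<in> K \<Longrightarrow> L k \<in> sets borel" and disj: "disjoint_family_on L K"
  shows "(\<Sum>k\<in>K. close_mass m g J (L k)) \<le> 2 * g * m * measure M (J \<inter> space M)"
proof -
  have "(\<Sum>k\<in>K. \<integral>x. hit i J x * hit i' (L k) x \<partial>M) \<le> measure M (J \<inter> space M)" for i i'
  proof -
    have "(\<Sum>k\<in>K. \<integral>x. hit i J x * hit i' (L k) x \<partial>M)
        = (\<integral>x. (\<Sum>k\<in>K. hit i J x * hit i' (L k) x) \<partial>M)"
      using L by (subst Bochner_Integration.integral_sum) auto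
    also have "\<dots> \<le> (\<integral>x. hit i J x \<partial>M)"
    proof (rule integral_mono)
      fix x
      have "(\<Sum>k\<in>K. hit i' (L k) x) = indicator (\<Union>k\<in>K. L k) ((T ^^ i') x)"
        unfolding hit_def using \<open>finite K\<close> disj by (simp add: indicator_UN_disjoint)
      then have "(\<Sum>k\<in>K. hit i' (L k) x) \<le> 1" by (simp add: indicator_def)
      then show "(\<Sum>k\<in>K. hit i J x * hit i' (L k) x) \<le> hit i J x"
        by (simp add: sum_distrib_left[symmetric] mult_left_le)
    qed (use L in auto)
    finally show ?thesis by (simp add: integral_hit)
  qed
  note row = this
  have "(\<Sum>k\<in>K. close_mass m g J (L k))
      = (\<Sum>i<m. \<Sum>i'\<in>close_pairs m g i. \<Sum>k\<in>K. \<integral>x. hit i J x * hit i' (L k) x \<partial>M)"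
    unfolding close_mass_def by (subst sum.swap) (intro sum.cong refl sum.swap)
  also have "\<dots> \<le> (\<Sum>i<m. \<Sum>i'\<in>close_pairs m g i. measure M (J \<inter> space M))"
    by (intro sum_mono row)
  also have "\<dots> = (\<Sum>i<m. real (card (close_pairs m g i)) * measure M (J \<inter> space M))"
    by simp
  also have "\<dots> \<le> (\<Sum>i<m. real (2 * g) * measure M (J \<inter> space M))"
    using card_close_pairs by (intro sum_mono mult_right_mono of_nat_mono) auto
  finally show ?thesis by (simp add: mult_ac)
qed

lemma close_mass_le:
  assumes "J \<in> sets borel" "L \<in> sets borel"
  shows "close_mass m g J L \<le> 2 * g * m * measure M (J \<inter> space M)"
  using close_mass_row[of "{()}" J "\<lambda>_. L" m g] assms by (simp add: disjoint_family_on_def)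

lemma integral_visits2:
  assumes "J \<in> sets borel" "L \<in> sets borel"
  shows "(\<integral>x. visits s m J x * visits s' m L x \<partial>M)
    = (\<Sum>i<m. \<Sum>i'<m. \<integral>x. hit (i + s) J x * hit (i' + s') L x \<partial>M)"
  unfolding visits_def sum_product using assms
  by (subst Bochner_Integration.integral_sum; (intro Bochner_Integration.integrable_sum)?; simp add: Bochner_Integration.integral_sum)

lemma integrable_visits2 [simp]:
  assumes "J \<in> sets borel" "L \<in> sets borel"
  shows "integrable M (\<lambda>x. visits s m J x * visits s' m L x)"
  unfolding visits_def sum_product using assms by auto

lemma visits4_eq:
  "visits 0 m J x * visits 0 m L x * (visits s m J x * visits s m L x)
    = (\<Sum>i<m. \<Sum>i'<m. \<Sum>j<m. \<Sum>j'<m.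
        hit i J x * hit i' L x * (hit (j + s) J x * hit (j' + s) L x))"
proof -
  have "visits 0 m J x * visits 0 m L x = (\<Sum>i<m. \<Sum>i'<m. hit i J x * hit i' L x)"
    "visits s m J x * visits s m L x = (\<Sum>j<m. \<Sum>j'<m. hit (j + s) J x * hit (j' + s) L x)"
    by (simp_all add: visits_def sum_product)
  then show ?thesis by (simp only: sum_distrib_left[symmetric] sum_distrib_right[symmetric])
qed

lemma integrable_visits4 [simp]:
  assumes "J \<in> sets borel" "L \<in> sets borel"
  shows "integrable M (\<lambda>x. visits 0 m J x * visits 0 m L x * (visits s m J x * visits s m L x))"
  unfolding visits4_eq by (intro Bochner_Integration.integrable_sum integrable_hit4 assms)

text \<open>Pairs of times at distance at least \<open>g\<close> decorrelate by
  \<open>two_point\<close>. The close pairs are kept as they stand, because summing them over the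
  cells gains more than bounding them one by one.\<close>

lemma visits2_le:
  assumes J: "is_interval J" "is_interval L" and "0 < g"
  shows "(\<integral>x. visits 0 m J x * visits 0 m L x \<partial>M)
    \<le> (real m)\<^sup>2 * (measure M (J \<inter> space M) * measure M (L \<inter> space M))
      + (real m)\<^sup>2 * (C * exp (- \<theta> * real g)) + close_mass m g J L"
proof -
  have [measurable]: "J \<in> sets borel" "L \<in> sets borel"
    using J by (auto intro: interval_borel)
  let ?e = "\<lambda>i i'. \<integral>x. hit i J x * hit i' L x \<partial>M"
  let ?b = "measure M (J \<inter> space M) * measure M (L \<inter> space M) + C * exp (- \<theta> * real g)"
  have b0: "0 \<le> ?b" using C_nonneg by simp
  have far: "?e i i' \<le> ?b" if *: "i' \<notin> close_pairs m g i" "i' < m" for i i'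
  proof -
    have exp_le: "C * exp (- \<theta> * real d) \<le> C * exp (- \<theta> * real g)" if "g \<le> d" for d
      using that C_nonneg \<theta>_pos by (intro mult_left_mono) auto
    consider "i' + g \<le> i" | "i + g \<le> i'" using * by (force simp: close_pairs_def)
    then show ?thesis
    proof cases
      case 1
      then have "g \<le> i - i'" by simp
      with 1 show ?thesis
        using two_point[of L J i' i] J exp_le[of "i - i'"] \<open>0 < g\<close> unfolding abs_le_iff
        by (simp add: mult.commute)
    next
      case 2
      then have "g \<le> i' - i" by simp
      with 2 show ?thesis
        using two_point[of J L i i'] J exp_le[of "i' - i"] \<open>0 < g\<close> unfolding abs_le_iff by simp
    qed
  qed
  have "(\<Sum>i'<m. ?e i i') \<le> m * ?b + (\<Sum>i'\<in>close_pairs m g i. ?e i i')" for i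
  proof -
    have "(\<Sum>i'<m. ?e i i') = (\<Sum>i'\<in>{..<m} - close_pairs m g i. ?e i i') + (\<Sum>i'\<in>close_pairs m g i. ?e i i')"
      by (rule sum.subset_diff) (auto simp: close_pairs_def)
    moreover have "(\<Sum>i'\<in>{..<m} - close_pairs m g i. ?e i i') \<le> (\<Sum>i'\<in>{..<m} - close_pairs m g i. ?b)"
      using far by (intro sum_mono) auto
    moreover have "(\<Sum>i'\<in>{..<m} - close_pairs m g i. ?b) \<le> (\<Sum>i'<m. ?b)"
      using b0 by (intro sum_mono2) auto
    ultimately show ?thesis by simp
  qed
  then have "(\<Sum>i<m. \<Sum>i'<m. ?e i i') \<le> (\<Sum>i<m. m * ?b + (\<Sum>i'\<in>close_pairs m g i. ?e i i'))"
    by (intro sum_mono)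
  also have "\<dots> = m * (m * ?b) + close_mass m g J L"
    by (simp add: sum.distrib close_mass_def)
  finally show ?thesis
    by (simp add: integral_visits2 power2_eq_square algebra_simps)
qed

text \<open>Times in the two blocks differ by more than \<open>m\<close>, so
  \<open>two_point\<close> applies to every pair.\<close>

lemma visits2_ge:
  assumes J: "is_interval J" and "0 < m"
  shows "(real m)\<^sup>2 * ((measure M (J \<inter> space M))\<^sup>2 - C * exp (- \<theta> * real m))
    \<le> (\<integral>x. visits 0 m J x * visits (2 * m) m J x \<partial>M)"
proof -
  have [measurable]: "J \<in> sets borel" using J by (rule interval_borel)
  have "(measure M (J \<inter> space M))\<^sup>2 - C * exp (- \<theta> * real m)
      \<le> (\<integral>x. hit i J x * hit (j + 2 * m) J x \<partial>M)" if "i < m" for i j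
  proof -
    have "C * exp (- \<theta> * real (j + 2 * m - i)) \<le> C * exp (- \<theta> * real m)"
      using that C_nonneg \<theta>_pos by (intro mult_left_mono) auto
    then show ?thesis
      using two_point[of J J i "j + 2 * m"] J that unfolding abs_le_iff
      by (simp add: power2_eq_square)
  qed
  then have "(\<Sum>i<m. \<Sum>j<m. (measure M (J \<inter> space M))\<^sup>2 - C * exp (- \<theta> * real m))
      \<le> (\<Sum>i<m. \<Sum>j<m. \<integral>x. hit (i + 0) J x * hit (j + 2 * m) J x \<partial>M)"
    by (intro sum_mono) auto
  then show ?thesis
    by (subst integral_visits2) (auto simp: power2_eq_square[of "real m"] mult.assoc)
qed

text \<open>The gap of more than \<open>m\<close> between the blocks factors each fourfold
  correlation into an early and a late pair correlation. By stationarity the late one equals an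
  early one, so the main term is a perfect square.\<close>

lemma visits4_le:
  assumes J: "is_interval J" "is_interval L"
  shows "(\<integral>x. visits 0 m J x * visits 0 m L x * (visits (2 * m) m J x * visits (2 * m) m L x) \<partial>M)
    \<le> (\<integral>x. visits 0 m J x * visits 0 m L x \<partial>M)\<^sup>2 + (real m)^4 * (C * exp (- \<theta> * real m))"
proof -
  have [measurable]: "J \<in> sets borel" "L \<in> sets borel"
    using J by (auto intro: interval_borel)
  let ?e = "\<lambda>i i'. \<integral>x. hit i J x * hit i' L x \<partial>M" and ?d = "C * exp (- \<theta> * real m)"
  have "(\<integral>x. hit i J x * hit i' L x * (hit (j + 2 * m) J x * hit (j' + 2 * m) L x) \<partial>M)
      \<le> ?e i i' * ?e j j' + ?d" if "i < m" "i' < m" for i i' j j'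
    using four_point[of J L J L i m "j + 2 * m" i' "j' + 2 * m"] that J
      integral_hit2_shift[of J L j "2 * m" j'] by simp
  then have "(\<Sum>i<m. \<Sum>i'<m. \<Sum>j<m. \<Sum>j'<m.
        \<integral>x. hit i J x * hit i' L x * (hit (j + 2 * m) J x * hit (j' + 2 * m) L x) \<partial>M)
      \<le> (\<Sum>i<m. \<Sum>i'<m. \<Sum>j<m. \<Sum>j'<m. ?e i i' * ?e j j' + ?d)"
    by (intro sum_mono) auto
  also have "\<dots> = (\<Sum>i<m. \<Sum>i'<m. ?e i i')\<^sup>2 + (real m)^4 * ?d"
    by (simp add: sum.distrib power2_eq_square sum_distrib_left[symmetric]
        sum_distrib_right[symmetric] power4_eq_xxxx)
  finally show ?thesis
    by (simp add: visits4_eq integral_visits2 Bochner_Integration.integral_sum)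
qed

section \<open>The second moment estimate\<close>

text \<open>Chebyshev's inequality for the number \<open>S\<close> of coincidences, centred at
  \<open>w\<close>, the mean under exact decorrelation. An upper bound for the second moment of
  \<open>S\<close> and a lower bound for its mean then suffice. The terms in
  \<open>\<epsilon>\<close> and \<open>\<delta>\<close> are mixing errors at distances
  \<open>g\<close> and \<open>m\<close>; those in \<open>u\<close> come from close pairs.\<close>

lemma no_coincidence_bound:
  fixes J :: "'k \<Rightarrow> real set"
  assumes K: "finite K" and J: "\<And>k. k \<in> K \<Longrightarrow> is_interval (J k)"
    and disj: "disjoint_family_on J K" and mg: "0 < m" "0 < g"
  defines "q \<equiv> \<Sum>k\<in>K. (measure M (J k \<inter> space M))\<^sup>2"
    and "\<epsilon> \<equiv> C * exp (- \<theta> * real g)" and "\<delta> \<equiv> C * exp (- \<theta> * real m)"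
    and "N \<equiv> real (card K)"
  defines "u \<equiv> real g / (real m * sqrt q)"
  assumes q: "0 < q"
  shows "measure M {x \<in> space M. \<forall>k\<in>K. \<forall>i<m. \<forall>j<m. \<not> ((T ^^ i) x \<in> J k \<and> (T ^^ (j + 2 * m)) x \<in> J k)}
    \<le> 2 * (\<epsilon> / q\<^sup>2) + 4 * u + 2 * (N * \<epsilon> / q)\<^sup>2 + 8 * u\<^sup>2 + N\<^sup>2 * \<delta> / q\<^sup>2 + 2 * N * \<delta> / q"
    (is "measure M ?E \<le> _")
proof -
  define \<mu> where "\<mu> k = measure M (J k \<inter> space M)" for k
  define S where "S x = (\<Sum>k\<in>K. visits 0 m (J k) x * visits (2 * m) m (J k) x)" for x
  define w where "w = (real m)\<^sup>2 * q"
  have w: "0 < w" using mg q by (simp add: w_def)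
  have \<epsilon>\<delta>: "0 \<le> \<epsilon>" "0 \<le> \<delta>" using C_nonneg by (auto simp: \<epsilon>_def \<delta>_def)
  have Jb [measurable]: "k \<in> K \<Longrightarrow> J k \<in> sets borel" for k
    using J by (auto intro: interval_borel)
  have S2: "(S x)\<^sup>2 = (\<Sum>k\<in>K. \<Sum>l\<in>K. visits 0 m (J k) x * visits 0 m (J l) x
      * (visits (2 * m) m (J k) x * visits (2 * m) m (J l) x))" for x
    unfolding S_def power2_eq_square sum_product by (intro sum.cong refl) (simp add: mult_ac)
  have int_S: "integrable M S" unfolding S_def[abs_def] using Jb by auto
  have int_S2: "integrable M (\<lambda>x. (S x)\<^sup>2)"
    unfolding S2 using Jb by (auto intro!: Bochner_Integration.integrable_sum)
  have sum_\<mu>: "(\<Sum>k\<in>K. \<mu> k) \<le> 1"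
  proof -
    have "(\<Sum>k\<in>K. \<mu> k) = measure M (\<Union>k\<in>K. J k \<inter> space M)"
      unfolding \<mu>_def using K disj Jb
      by (intro finite_measure_finite_Union[symmetric]) (auto simp: disjoint_family_on_def)
    then show ?thesis by simp
  qed
  have "(\<integral>x. (S x)\<^sup>2 \<partial>M) = (\<Sum>k\<in>K. \<Sum>l\<in>K. \<integral>x. visits 0 m (J k) x * visits 0 m (J l) x
      * (visits (2 * m) m (J k) x * visits (2 * m) m (J l) x) \<partial>M)"
    unfolding S2 using Jb
    by (subst Bochner_Integration.integral_sum; (intro Bochner_Integration.integrable_sum)?; simp add: Bochner_Integration.integral_sum)
  also have "\<dots> \<le> (\<Sum>k\<in>K. \<Sum>l\<in>K. ((real m)\<^sup>2 * (\<mu> k * \<mu> l) + (real m)\<^sup>2 * \<epsilon> + close_mass m g (J k) (J l))\<^sup>2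
      + (real m)^4 * \<delta>)"
  proof (intro sum_mono)
    fix k l assume kl: "k \<in> K" "l \<in> K"
    \<comment> \<open>Nonnegativity allows the bound of \<open>visits2_le\<close> to be
      squared.\<close>
    have "0 \<le> (\<integral>x. visits 0 m (J k) x * visits 0 m (J l) x \<partial>M)"
      unfolding visits_def by (intro Bochner_Integration.integral_nonneg mult_nonneg_nonneg sum_nonneg hit_nonneg)
    then have "(\<integral>x. visits 0 m (J k) x * visits 0 m (J l) x \<partial>M)\<^sup>2
        \<le> ((real m)\<^sup>2 * (\<mu> k * \<mu> l) + (real m)\<^sup>2 * \<epsilon> + close_mass m g (J k) (J l))\<^sup>2"
      using visits2_le[of "J k" "J l" g m] J[OF kl(1)] J[OF kl(2)] mg
      by (intro power_mono) (auto simp: \<mu>_def \<epsilon>_def)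
    then show "(\<integral>x. visits 0 m (J k) x * visits 0 m (J l) x
        * (visits (2 * m) m (J k) x * visits (2 * m) m (J l) x) \<partial>M)
        \<le> ((real m)\<^sup>2 * (\<mu> k * \<mu> l) + (real m)\<^sup>2 * \<epsilon> + close_mass m g (J k) (J l))\<^sup>2 + (real m)^4 * \<delta>"
      using visits4_le[of "J k" "J l" m] J[OF kl(1)] J[OF kl(2)] by (simp add: \<delta>_def)
  qed
  also have "\<dots> = (\<Sum>k\<in>K. \<Sum>l\<in>K. ((real m)\<^sup>2 * (\<mu> k * \<mu> l) + (real m)\<^sup>2 * \<epsilon> + close_mass m g (J k) (J l))\<^sup>2)
      + N\<^sup>2 * (real m)^4 * \<delta>"
    by (simp add: sum.distrib N_def power2_eq_square[of "real (card K)"])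
  \<comment> \<open>The inequality for perturbed squares, with \<open>a\<close> the square of
    \<open>m\<close>, \<open>e\<close> equal to \<open>\<epsilon>\<close> times that square, and
    \<open>G = 2 * g * m\<close>.\<close>
  also have "(\<Sum>k\<in>K. \<Sum>l\<in>K. ((real m)\<^sup>2 * (\<mu> k * \<mu> l) + (real m)\<^sup>2 * \<epsilon> + close_mass m g (J k) (J l))\<^sup>2)
      \<le> ((real m)\<^sup>2)\<^sup>2 * q\<^sup>2 + 2 * (real m)\<^sup>2 * ((real m)\<^sup>2 * \<epsilon> + (2 * g * m) * (q * sqrt q))
        + 2 * (N\<^sup>2 * ((real m)\<^sup>2 * \<epsilon>)\<^sup>2 + (real (2 * g * m))\<^sup>2 * q)"
    unfolding q_def N_def \<mu>_def[symmetric]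
  proof (rule sum_squares_perturbed_le[OF K])
    show "(\<Sum>k\<in>K. close_mass m g (J k) (J l)) \<le> real (2 * g * m) * \<mu> l" if "l \<in> K" for l
      using close_mass_row[OF K Jb[OF that] Jb disj, of m g]
      by (simp add: close_mass_commute[of m g _ "J l"] \<mu>_def)
  qed (use close_mass_row[OF K Jb Jb disj, of _ m g] close_mass_le Jb sum_\<mu> \<epsilon>\<delta> in
      \<open>auto simp: \<mu>_def close_mass_nonneg\<close>)
  finally have ES2: "(\<integral>x. (S x)\<^sup>2 \<partial>M)
      \<le> ((real m)\<^sup>2)\<^sup>2 * q\<^sup>2 + 2 * (real m)\<^sup>2 * ((real m)\<^sup>2 * \<epsilon> + (2 * g * m) * (q * sqrt q))
        + 2 * (N\<^sup>2 * ((real m)\<^sup>2 * \<epsilon>)\<^sup>2 + (real (2 * g * m))\<^sup>2 * q) + N\<^sup>2 * (real m)^4 * \<delta>"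
    by simp
  have ES: "w - (real m)\<^sup>2 * N * \<delta> \<le> (\<integral>x. S x \<partial>M)"
  proof -
    have "w - (real m)\<^sup>2 * N * \<delta> = (\<Sum>k\<in>K. (real m)\<^sup>2 * ((measure M (J k \<inter> space M))\<^sup>2 - \<delta>))"
      by (simp add: w_def q_def N_def sum_distrib_left[symmetric] sum_subtractf algebra_simps)
    also have "\<dots> \<le> (\<Sum>k\<in>K. \<integral>x. visits 0 m (J k) x * visits (2 * m) m (J k) x \<partial>M)"
      unfolding \<delta>_def using J mg by (intro sum_mono visits2_ge)
    also have "\<dots> = (\<integral>x. S x \<partial>M)"
      unfolding S_def using Jb by (simp add: Bochner_Integration.integral_sum)
    finally show ?thesis .
  qed
  have int_dev: "integrable M (\<lambda>x. (S x - w)\<^sup>2 / w\<^sup>2)"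
    unfolding power2_diff using int_S int_S2 by auto
  have E: "?E \<in> sets M"
    using K by measurable
  have "?E \<inter> space M = ?E" by auto
  then have "measure M ?E = (\<integral>x. indicator ?E x \<partial>M)"
    by (metis Bochner_Integration.integral_indicator)
  \<comment> \<open>Without a coincidence every product of visit counts vanishes, so
    \<open>S x = 0\<close> and the right-hand integrand is 1.\<close>
  also have "\<dots> \<le> (\<integral>x. (S x - w)\<^sup>2 / w\<^sup>2 \<partial>M)"
  proof (rule integral_mono[OF _ int_dev])
    fix x
    show "indicator ?E x \<le> (S x - w)\<^sup>2 / w\<^sup>2"
    proof (cases "x \<in> ?E")
      case True
      then have "S x = 0"
        unfolding S_def visits_def sum_product hit_def
        by (intro sum.neutral ballI) (auto simp: indicator_def)
      then show ?thesis using True w by simp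
    qed simp
  qed (intro integrable_real_indicator E, simp add: emeasure_eq_measure)
  also have "\<dots> = ((\<integral>x. (S x)\<^sup>2 \<partial>M) - 2 * w * (\<integral>x. S x \<partial>M) + w\<^sup>2) / w\<^sup>2"
    unfolding power2_diff using int_S int_S2 by (simp add: prob_space mult_ac)
  also have "\<dots> \<le> (((real m)\<^sup>2)\<^sup>2 * q\<^sup>2 + 2 * (real m)\<^sup>2 * ((real m)\<^sup>2 * \<epsilon> + (2 * g * m) * (q * sqrt q))
        + 2 * (N\<^sup>2 * ((real m)\<^sup>2 * \<epsilon>)\<^sup>2 + (real (2 * g * m))\<^sup>2 * q) + N\<^sup>2 * (real m)^4 * \<delta>
        - 2 * w * (w - (real m)\<^sup>2 * N * \<delta>) + w\<^sup>2) / w\<^sup>2"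
    using ES2 ES w by (intro divide_right_mono add_mono diff_mono mult_left_mono order_refl) auto
  \<comment> \<open>The leading contributions of second moment, mean and centre are
    \<open>w\<^sup>2\<close>, \<open>-2 * w\<^sup>2\<close> and \<open>w\<^sup>2\<close>, and
    cancel.\<close>
  also have "\<dots> = 2 * (\<epsilon> / q\<^sup>2) + 4 * u + 2 * (N * \<epsilon> / q)\<^sup>2 + 8 * u\<^sup>2 + N\<^sup>2 * \<delta> / q\<^sup>2 + 2 * N * \<delta> / q"
  proof -
    obtain s where s: "0 < s" "q = s\<^sup>2" using q by (intro that[of "sqrt q"]) auto
    have "sqrt q = s" using s by simp
    then show ?thesis using s mg unfolding u_def w_def
      by (simp add: field_simps power2_eq_square power4_eq_xxxx)
  qed
  finally show ?thesis .
qed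

section \<open>Heavy cells and the choice of a grid\<close>

definition heavy_cells :: "real \<Rightarrow> real \<Rightarrow> real \<Rightarrow> int set" where
  "heavy_cells r s t = {k. t \<le> measure M (cell r s k \<inter> space M)}"

text \<open>Disjoint sets of measure at least \<open>t\<close> in a probability space number at most
  \<open>1 / t\<close>. The bound is shown first for finite subfamilies, and finiteness follows from
  its uniformity.\<close>

lemma heavy_cells:
  assumes r: "0 < r" and t: "0 < t"
  shows finite_heavy_cells: "finite (heavy_cells r s t)"
    and card_heavy_cells: "real (card (heavy_cells r s t)) * t \<le> 1"
proof -
  have *: "real (card F) * t \<le> 1" if "F \<subseteq> heavy_cells r s t" "finite F" for F
  proof -
    have "real (card F) * t = (\<Sum>k\<in>F. t)" by simp
    also have "\<dots> \<le> (\<Sum>k\<in>F. measure M (cell r s k \<inter> space M))"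
      using that by (intro sum_mono) (auto simp: heavy_cells_def)
    also have "\<dots> = measure M (\<Union>k\<in>F. cell r s k \<inter> space M)"
      using that r by (intro finite_measure_finite_Union[symmetric])
        (auto simp: disjoint_family_on_def cell_def[of r s] intro!: borel_Int_space cell_borel)
    finally show ?thesis using prob_le_1[of "\<Union>k\<in>F. cell r s k \<inter> space M"] by linarith
  qed
  have "card F \<le> nat \<lceil>1 / t\<rceil>" if "F \<subseteq> heavy_cells r s t" "finite F" for F
    using *[OF that] t by (simp add: le_nat_iff pos_le_divide_eq[symmetric] le_ceiling_iff)
  then show "finite (heavy_cells r s t)"
    using finite_if_finite_subsets_card_bdd[of "heavy_cells r s t" "nat \<lceil>1 / t\<rceil>"] by blast
  then show "real (card (heavy_cells r s t)) * t \<le> 1" using * by blast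
qed

text \<open>Every ball of radius \<open>r\<close> lies in a single cell of one of two grids of mesh \<open>4r\<close>, offset
  by \<open>2r\<close>, so one of the grids captures half of the correlation integral. Discarding the light cells
  costs little and leaves at most \<open>1/p\<close> cells, even when the state space is unbounded.\<close>

lemma exists_good_grid:
  assumes r: "0 < r" and p: "0 < p" and corr: "4 * p \<le> (\<integral>y. measure M (ball y r \<inter> space M) \<partial>M)"
  shows "\<exists>s. p \<le> (\<Sum>k\<in>heavy_cells r s p. (measure M (cell r s k \<inter> space M))\<^sup>2)"
proof -
  define \<mu> where "\<mu> s k = measure M (cell r s k \<inter> space M)" for s k
  \<comment> \<open>This dominates the mass of the cell containing \<open>y\<close>: a heavy cell
    appears in the sum, a light one has mass below \<open>p\<close>. Its integral is
    \<open>p\<close> plus the sum of squares that is to be bounded.\<close>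
  define f where "f s y = p + (\<Sum>k\<in>heavy_cells r s p. \<mu> s k * hit 0 (cell r s k) y)" for s y
  have f_nonneg: "p \<le> f s y" for s y
    unfolding f_def by (auto intro!: sum_nonneg simp: \<mu>_def)
  have int_f: "integrable M (f s)" for s
    unfolding f_def[abs_def] using r by auto
  have integral_f: "(\<integral>y. f s y \<partial>M) = p + (\<Sum>k\<in>heavy_cells r s p. (\<mu> s k)\<^sup>2)" for s
    unfolding f_def using r
    by (simp add: Bochner_Integration.integral_sum integral_hit prob_space \<mu>_def power2_eq_square)
  have \<mu>_le_f: "\<mu> s \<lfloor>(y - s) / (4 * r)\<rfloor> \<le> f s y" for s y
  proof (cases "\<lfloor>(y - s) / (4 * r)\<rfloor> \<in> heavy_cells r s p")
    case True
    have "\<mu> s \<lfloor>(y - s) / (4 * r)\<rfloor> * hit 0 (cell r s \<lfloor>(y - s) / (4 * r)\<rfloor>) y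
        \<le> (\<Sum>k\<in>heavy_cells r s p. \<mu> s k * hit 0 (cell r s k) y)"
      using True finite_heavy_cells[OF r p, of s]
      by (intro member_le_sum[where f = "\<lambda>k. \<mu> s k * hit 0 (cell r s k) y"]) (auto simp: \<mu>_def)
    then show ?thesis using p by (simp add: f_def hit_def cell_def)
  next
    case False
    then have "\<mu> s \<lfloor>(y - s) / (4 * r)\<rfloor> \<le> p" by (simp add: heavy_cells_def \<mu>_def)
    then show ?thesis using f_nonneg[of s y] by simp
  qed
  have "(\<integral>y. measure M (ball y r \<inter> space M) \<partial>M) \<le> (\<integral>y. f 0 y + f (2 * r) y \<partial>M)"
  proof (rule integral_mono')
    fix y
    have "measure M (ball y r \<inter> space M) \<le> \<mu> s \<lfloor>(y - s) / (4 * r)\<rfloor>"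
      if "ball y r \<subseteq> cell r s \<lfloor>(y - s) / (4 * r)\<rfloor>" for s
      unfolding \<mu>_def using that r by (intro finite_measure_mono) auto
    then have "measure M (ball y r \<inter> space M) \<le> f 0 y \<or> measure M (ball y r \<inter> space M) \<le> f (2 * r) y"
      using ball_subset_cell[OF r, of y] order_trans[OF _ \<mu>_le_f[of 0 y]]
        order_trans[OF _ \<mu>_le_f[of "2 * r" y]] by (metis diff_zero)
    then show "measure M (ball y r \<inter> space M) \<le> f 0 y + f (2 * r) y"
      using f_nonneg[of 0 y] f_nonneg[of "2 * r" y] p by linarith
    \<comment> \<open>The rule \<open>integral_mono'\<close> asks for this in place of integrability
      of the ball mass, as a non-integrable function has integral 0 by default.\<close>
    show "0 \<le> f 0 y + f (2 * r) y"
      using f_nonneg[of 0 y] f_nonneg[of "2 * r" y] p by linarith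
  qed (use int_f in auto)
  \<comment> \<open>The two integrals contain \<open>p\<close> twice, so the two sums of squares
    together are at least \<open>2 * p\<close> and one of them is at least \<open>p\<close>.\<close>
  then have "4 * p \<le> (\<integral>y. f 0 y \<partial>M) + (\<integral>y. f (2 * r) y \<partial>M)"
    using corr int_f by simp
  then have "p \<le> (\<Sum>k\<in>heavy_cells r 0 p. (\<mu> 0 k)\<^sup>2) \<or> p \<le> (\<Sum>k\<in>heavy_cells r (2 * r) p. (\<mu> (2 * r) k)\<^sup>2)"
    unfolding integral_f by linarith
  then show ?thesis unfolding \<mu>_def by blast
qed

section \<open>The probability of a close return and its limit\<close>

lemma Fset_measurable [measurable]: "Fset M T n r \<in> sets M"
  unfolding Fset_def by measurable

text \<open>Two visits to one cell are closer than \<open>4 * r\<close>, so off \<open>Fset\<close>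
  there is no coincidence in a good grid. With \<open>N\<close> at most \<open>1 / p\<close> and
  \<open>q\<close> at least \<open>p\<close>, the bound is expressed through \<open>p\<close>
  alone.\<close>

lemma prob_compl_Fset_le:
  assumes r: "0 < r" and p: "0 < p" and corr: "4 * p \<le> (\<integral>y. measure M (ball y r \<inter> space M) \<partial>M)"
    and mg: "0 < m" "0 < g" and n: "3 * m \<le> n"
  defines "\<epsilon> \<equiv> C * exp (- \<theta> * real g)" and "\<delta> \<equiv> C * exp (- \<theta> * real m)"
    and "u \<equiv> real g / (real m * sqrt p)"
  shows "1 - measure M (Fset M T n (4 * r))
    \<le> 2 * (\<epsilon> / p\<^sup>2) + 4 * u + 2 * (\<epsilon> / p\<^sup>2)\<^sup>2 + 8 * u\<^sup>2 + \<delta> / p^4 + 2 * (\<delta> / p\<^sup>2)"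
proof -
  obtain s where s: "p \<le> (\<Sum>k\<in>heavy_cells r s p. (measure M (cell r s k \<inter> space M))\<^sup>2)"
    using exists_good_grid[OF r p corr] by blast
  let ?K = "heavy_cells r s p"
  define q where "q = (\<Sum>k\<in>?K. (measure M (cell r s k \<inter> space M))\<^sup>2)"
  define N where "N = real (card ?K)"
  have q: "p \<le> q" "0 < q" using s p by (auto simp: q_def)
  have N: "0 \<le> N" "N \<le> 1 / p"
    using card_heavy_cells[OF r p, of s] p by (auto simp: N_def pos_le_divide_eq)
  have \<epsilon>\<delta>: "0 \<le> \<epsilon>" "0 \<le> \<delta>" using C_nonneg by (auto simp: \<epsilon>_def \<delta>_def)
  let ?E = "{x \<in> space M. \<forall>k\<in>?K. \<forall>i<m. \<forall>j<m.
    \<not> ((T ^^ i) x \<in> cell r s k \<and> (T ^^ (j + 2 * m)) x \<in> cell r s k)}"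
  have fin: "finite ?K" by (rule finite_heavy_cells[OF r p])
  have [measurable]: "cell r s k \<in> sets borel" for k using r by simp
  have E: "?E \<in> sets M" using fin by measurable
  have "space M - Fset M T n (4 * r) \<subseteq> ?E"
  proof (intro subsetI CollectI conjI ballI allI impI notI)
    fix x k i j
    assume x: "x \<in> space M - Fset M T n (4 * r)" and ij: "i < m" "j < m"
      and "(T ^^ i) x \<in> cell r s k \<and> (T ^^ (j + 2 * m)) x \<in> cell r s k"
    then have "\<bar>(T ^^ i) x - (T ^^ (j + 2 * m)) x\<bar> < 4 * r"
      using cell_diameter[OF r] by blast
    moreover have "i < j + 2 * m" "j + 2 * m < n" using ij n by auto
    ultimately show False using x unfolding Fset_def by blast
  qed auto
  then have "measure M (space M - Fset M T n (4 * r)) \<le> measure M ?E"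
    using E by (rule finite_measure_mono)
  also have "\<dots> \<le> 2 * (\<epsilon> / q\<^sup>2) + 4 * (real g / (real m * sqrt q)) + 2 * (N * \<epsilon> / q)\<^sup>2
      + 8 * (real g / (real m * sqrt q))\<^sup>2 + N\<^sup>2 * \<delta> / q\<^sup>2 + 2 * N * \<delta> / q"
    unfolding q_def N_def \<epsilon>_def \<delta>_def
    by (rule no_coincidence_bound[OF fin is_interval_cell[OF r] disjoint_cells mg])
      (use q in \<open>simp add: q_def\<close>)
  also have "\<dots> \<le> 2 * (\<epsilon> / p\<^sup>2) + 4 * u + 2 * (\<epsilon> / p\<^sup>2)\<^sup>2 + 8 * u\<^sup>2 + \<delta> / p^4 + 2 * (\<delta> / p\<^sup>2)"
  proof -
    have u: "real g / (real m * sqrt q) \<le> u"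
      unfolding u_def using q p mg by (intro divide_left_mono mult_left_mono) auto
    have 1: "\<epsilon> / q\<^sup>2 \<le> \<epsilon> / p\<^sup>2"
      using q p \<epsilon>\<delta> by (intro divide_left_mono power_mono) auto
    have Nq: "N / q \<le> 1 / p\<^sup>2" "0 \<le> N / q"
      using frac_le[of "1 / p" N p q] N q p by (auto simp: power2_eq_square)
    have 2: "N * \<epsilon> / q \<le> \<epsilon> / p\<^sup>2"
      using mult_right_mono[OF Nq(1) \<epsilon>\<delta>(1)] by simp
    have 3: "N\<^sup>2 * \<delta> / q\<^sup>2 \<le> \<delta> / p^4"
      using mult_right_mono[OF power_mono[OF Nq, of 2] \<epsilon>\<delta>(2)] by (simp add: power_divide power_mult[symmetric])
    have 4: "2 * N * \<delta> / q \<le> 2 * (\<delta> / p\<^sup>2)"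
      using mult_right_mono[OF Nq(1) \<epsilon>\<delta>(2)] by simp
    show ?thesis
      using u 1 2 3 4 N q \<epsilon>\<delta> by (intro add_mono mult_left_mono power_mono) auto
  qed
  finally show ?thesis by (simp add: prob_compl)
qed

text \<open>With \<open>p\<close> a quarter of the assumed lower bound, \<open>m\<close> about
  \<open>n / 3\<close> and \<open>g\<close> a multiple of \<open>ln n\<close>, all terms of the
  preceding bound tend to 0.\<close>

lemma prob_limsup_Fset_eq_1:
  assumes r: "\<And>n. 0 < r n" and h: "filterlim h at_top sequentially"
    and corr: "eventually (\<lambda>n. (ln (real n))\<^sup>2 * h n / (real n)\<^sup>2
        \<le> (\<integral>y. measure M (ball y (r n) \<inter> space M) \<partial>M)) sequentially"
  shows "measure M (limsup (\<lambda>n. Fset M T n (4 * r n))) = 1"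
proof (rule prob_limsup_eq_1)
  define p where "p n = (ln (real n))\<^sup>2 * h n / (4 * (real n)\<^sup>2)" for n
  \<comment> \<open>The factor 5 makes \<open>\<epsilon>\<close> at most \<open>C / n ^ 5\<close>,
    which beats the inverse square of \<open>p\<close>, at most \<open>n ^ 4\<close>.\<close>
  define g where "g n = nat \<lceil>5 * ln (real n) / \<theta>\<rceil>" for n :: nat
  define m where "m n = n div 3" for n :: nat
  define \<epsilon> where "\<epsilon> n = C * exp (- \<theta> * real (g n))" for n
  define \<delta> where "\<delta> n = C * exp (- \<theta> * real (m n))" for n
  define u where "u n = real (g n) / (real (m n) * sqrt (p n))" for n
  have \<epsilon>\<delta>: "0 \<le> \<epsilon> n" "0 \<le> \<delta> n" for n using C_nonneg by (auto simp: \<epsilon>_def \<delta>_def)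
  \<comment> \<open>From 8 on, \<open>n div 3\<close> is at least \<open>n / 4\<close>.\<close>
  have n8: "eventually (\<lambda>n. 8 \<le> n) sequentially" by (rule eventually_ge_at_top)
  have h1: "eventually (\<lambda>n. 1 \<le> h n) sequentially"
    using h by (simp add: filterlim_at_top)
  \<comment> \<open>Then the squared logarithm is at least 4 and makes up for the 4 in the
    denominator of \<open>p\<close>.\<close>
  have ln2: "eventually (\<lambda>n. 2 \<le> ln (real n)) sequentially" by real_asymp
  have p_ge: "eventually (\<lambda>n. 1 / (real n)\<^sup>2 \<le> p n \<and> 0 < p n) sequentially"
    using h1 ln2 n8
  proof eventually_elim
    case (elim n)
    have "2\<^sup>2 * 1 \<le> (ln (real n))\<^sup>2 * h n" using elim by (intro mult_mono power_mono) auto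
    then have "1 / (real n)\<^sup>2 \<le> p n" using elim by (simp add: p_def field_simps)
    moreover have "0 < 1 / (real n)\<^sup>2" using elim by simp
    ultimately show ?case by linarith
  qed
  have inverse_p: "eventually (\<lambda>n. 1 / p n \<le> (real n)\<^sup>2) sequentially"
    using p_ge n8 by eventually_elim (simp add: field_simps)
  have \<epsilon>_lim: "(\<lambda>n. \<epsilon> n / (p n)\<^sup>2) \<longlonglongrightarrow> 0"
  proof (rule tendsto_sandwich[OF _ _ tendsto_const])
    show "eventually (\<lambda>n. 0 \<le> \<epsilon> n / (p n)\<^sup>2) sequentially" using \<epsilon>\<delta> by simp
    show "eventually (\<lambda>n. \<epsilon> n / (p n)\<^sup>2 \<le> C / real n) sequentially"
      using p_ge inverse_p n8
    proof eventually_elim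
      case (elim n)
      have "5 * ln (real n) / \<theta> \<le> real (g n)" unfolding g_def by (rule real_nat_ceiling_ge)
      then have "5 * ln (real n) \<le> \<theta> * real (g n)" using \<theta>_pos by (simp add: field_simps)
      then have "exp (- \<theta> * real (g n)) \<le> exp (- (real 5 * ln (real n)))" by simp
      also have "\<dots> = 1 / real n ^ 5"
        using elim unfolding exp_minus exp_of_nat_mult by (simp add: field_simps)
      finally have "\<epsilon> n \<le> C * (1 / real n ^ 5)"
        unfolding \<epsilon>_def using C_nonneg by (intro mult_left_mono)
      moreover have "(1 / p n)\<^sup>2 \<le> ((real n)\<^sup>2)\<^sup>2" using elim by (intro power_mono) auto
      ultimately have "\<epsilon> n * (1 / p n)\<^sup>2 \<le> C * (1 / real n ^ 5) * ((real n)\<^sup>2)\<^sup>2"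
        using \<epsilon>\<delta> C_nonneg by (intro mult_mono) auto
      also have "\<dots> = C / real n" using elim by (simp add: field_simps power_numeral_reduce)
      finally show ?case by (simp add: power_divide)
    qed
    show "(\<lambda>n. C / real n) \<longlonglongrightarrow> 0" by real_asymp
  qed
  have \<delta>_lim: "(\<lambda>n. \<delta> n / (p n)^j) \<longlonglongrightarrow> 0" for j
  proof (rule tendsto_sandwich[OF _ _ tendsto_const])
    show "eventually (\<lambda>n. 0 \<le> \<delta> n / (p n)^j) sequentially"
      using p_ge by eventually_elim (simp add: \<epsilon>\<delta>)
    show "eventually (\<lambda>n. \<delta> n / (p n)^j \<le> C * exp (- \<theta> * (real n / 4)) * real n ^ (2 * j)) sequentially"
      using p_ge inverse_p n8
    proof eventually_elim
      case (elim n)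
      have "real n / 4 \<le> real (m n)" using elim unfolding m_def by linarith
      then have "\<delta> n \<le> C * exp (- \<theta> * (real n / 4))"
        unfolding \<delta>_def using C_nonneg \<theta>_pos by (intro mult_left_mono) auto
      moreover have "(1 / p n)^j \<le> ((real n)\<^sup>2)^j" using elim by (intro power_mono) auto
      ultimately have "\<delta> n * (1 / p n)^j \<le> C * exp (- \<theta> * (real n / 4)) * ((real n)\<^sup>2)^j"
        using \<epsilon>\<delta> C_nonneg elim by (intro mult_mono) auto
      then show ?case by (simp add: power_divide power_mult)
    qed
    show "(\<lambda>n. C * exp (- \<theta> * (real n / 4)) * real n ^ (2 * j)) \<longlonglongrightarrow> 0"
      using \<theta>_pos by real_asymp
  qed
  \<comment> \<open>The logarithm in \<open>g\<close> cancels against the one in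
    \<open>sqrt (p n)\<close>, which leaves a multiple of \<open>1 / sqrt (h n)\<close>: this is the
    role of the squared logarithm and of the divergence of \<open>h\<close>.\<close>
  have u_lim: "u \<longlonglongrightarrow> 0"
  proof (rule tendsto_sandwich[OF _ _ tendsto_const])
    show "eventually (\<lambda>n. 0 \<le> u n) sequentially"
      using p_ge by eventually_elim (simp add: u_def)
    show "eventually (\<lambda>n. u n \<le> 8 * (5 / \<theta> + 1) / sqrt (h n)) sequentially"
      using p_ge h1 ln2 n8
    proof eventually_elim
      case (elim n)
      have m: "real n / 4 \<le> real (m n)" using elim unfolding m_def by linarith
      have "0 \<le> 5 * ln (real n) / \<theta>" using elim \<theta>_pos by simp
      then have "real (g n) \<le> 5 * ln (real n) / \<theta> + 1" unfolding g_def by linarith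
      also have "\<dots> \<le> 5 * ln (real n) / \<theta> + ln (real n)" using elim by simp
      also have "\<dots> = (5 / \<theta> + 1) * ln (real n)" by (simp add: algebra_simps)
      finally have g: "real (g n) \<le> (5 / \<theta> + 1) * ln (real n)" .
      have sp: "sqrt (p n) = ln (real n) * sqrt (h n) / (2 * real n)"
        using elim by (simp add: p_def real_sqrt_divide real_sqrt_mult)
      have "u n \<le> (5 / \<theta> + 1) * ln (real n) / (real n / 4 * sqrt (p n))"
        unfolding u_def using m g elim \<theta>_pos by (intro frac_le mult_right_mono) auto
      also have "\<dots> = 8 * (5 / \<theta> + 1) / sqrt (h n)"
        unfolding sp using elim by (simp add: field_simps)
      finally show ?case .
    qed
    show "(\<lambda>n. 8 * (5 / \<theta> + 1) / sqrt (h n)) \<longlonglongrightarrow> 0"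
      by (intro tendsto_divide_0[OF tendsto_const] filterlim_at_top_imp_at_infinity
          filterlim_compose[OF sqrt_at_top h])
  qed
  let ?b = "\<lambda>n. 2 * (\<epsilon> n / (p n)\<^sup>2) + 4 * u n + 2 * (\<epsilon> n / (p n)\<^sup>2)\<^sup>2 + 8 * (u n)\<^sup>2
    + \<delta> n / (p n)^4 + 2 * (\<delta> n / (p n)\<^sup>2)"
  have "?b \<longlonglongrightarrow> 2 * 0 + 4 * 0 + 2 * 0\<^sup>2 + 8 * 0\<^sup>2 + 0 + 2 * 0"
    by (intro tendsto_intros \<epsilon>_lim \<delta>_lim u_lim)
  then have "(\<lambda>n. 1 - ?b n) \<longlonglongrightarrow> 1" using tendsto_diff[OF tendsto_const, of ?b 0 _ 1] by simp
  moreover have "eventually (\<lambda>n. 1 - ?b n \<le> measure M (Fset M T n (4 * r n))) sequentially"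
    using p_ge ln2 n8 corr
  proof eventually_elim
    case (elim n)
    have "0 < 5 * ln (real n) / \<theta>" using elim \<theta>_pos by simp
    then have "0 < g n" unfolding g_def by linarith
    moreover have "0 < m n" "3 * m n \<le> n" using elim by (auto simp: m_def)
    moreover have "4 * p n = (ln (real n))\<^sup>2 * h n / (real n)\<^sup>2"
      by (simp add: p_def)
    ultimately have "1 - measure M (Fset M T n (4 * r n)) \<le> ?b n"
      unfolding \<epsilon>_def \<delta>_def u_def using elim r by (intro prob_compl_Fset_le) auto
    then show ?case by linarith
  qed
  ultimately show "(\<lambda>n. measure M (Fset M T n (4 * r n))) \<longlonglongrightarrow> 1"
    by (rule tendsto_sandwich[OF _ _ _ tendsto_const, rotated 2]) simp
qed simp

end

section \<open>Reduction of the theorem to the mixing locale\<close>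

theorem mainTheorem15:
  fixes M :: "real measure" and X :: "real set" and T :: "real \<Rightarrow> real"
    and r :: "nat \<Rightarrow> real" and \<beta> :: real and h :: "nat \<Rightarrow> real"
  assumes "is_interval X"
    and "space M = X" and "sets M = sets (restrict_space borel X)"
    and "prob_space M"
    and "T \<in> M \<rightarrow>\<^sub>M M" and "distr M M T = M"
    and "exp_4mixing_BV_Linfty_unif M T"
    and "\<beta> > 0" and "\<And>n. r n > 0" and "\<And>n. r n \<ge> real n powr (- \<beta>)"
    and "filterlim h at_top sequentially"
    and "eventually (\<lambda>n. (\<integral>y. measure M (ball y (r n) \<inter> X) \<partial>M)
                         \<ge> (ln (real n))\<^sup>2 * h n / (real n)\<^sup>2) sequentially"
  shows "measure M (limsup (\<lambda>n. Fset M T n (4 * r n))) = 1"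
proof -
  interpret prob_space M by fact
  obtain \<theta> C where \<theta>: "\<theta> > 0" and mix: "\<And>I1 I2 I3 I4 a b c. is_interval I1 \<Longrightarrow> is_interval I2 \<Longrightarrow>
      is_interval I3 \<Longrightarrow> is_interval I4 \<Longrightarrow> a < b \<Longrightarrow> b \<le> c \<Longrightarrow>
      corr4 M T (indicator I1) (indicator I2) (indicator I3) (indicator I4) a b c
        \<le> C * exp (- \<theta> * real (b - a))"
    using assms(7) unfolding exp_4mixing_BV_Linfty_unif_def by metis
  \<comment> \<open>Any instance of the mixing bound forces \<open>C\<close> to be nonnegative,
    since \<open>corr4\<close> is an absolute value.\<close>
  have "0 \<le> corr4 M T (indicator {}) (indicator {}) (indicator {}) (indicator {}) 0 1 1"
    by (simp add: corr4_def)
  also have "\<dots> \<le> C * exp (- \<theta> * real (1 - 0))" by (rule mix) auto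
  finally have C: "0 \<le> C" by (simp add: zero_le_mult_iff)
  interpret interval_mixing M T C \<theta>
    using assms \<theta> C mix by unfold_locales auto
  show ?thesis
    using assms by (intro prob_limsup_Fset_eq_1) auto
qed

end
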